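(* Let $\mathcal{A}$ be a supersolvable real central hyperplane arrangement with fundamental chamber $c_0$ incident to a modular flag. \begin{enumerate} \item For $I\subseteq\mathcal{A}$, there exists a chamber $c$ with $I=S(c_0,c)$ if and only if $I$ is biclosed. \item For chambers $c,d$, the separation set $S(c\vee d)$ is the 2-closure of $S(c)\cup S(d)$. \end{enumerate}
   Context: $\mathcal{A}$ is a finite set of linear hyperplanes in $\mathbb{R}^n$ of rank $r$ (codimension of the intersection of all hyperplanes); chambers are the connected components of the complement of their union. $L(\mathcal{A})$ is the set of intersections of subsets of $\mathcal{A}$ ordered by reverse inclusion, $L_i(\mathcal{A})$ those of codimension $i$. $X\in L(\mathcal{A})$ is modular if $X+Y\in L(\mathcal{A})$ for all $Y\in L(\mathcal{A})$. A modular flag is a chain $X_0<X_1<\cdots<X_r$ with $X_i\in L_i(\mathcal{A})$ modular; $\mathcal{A}$ is supersolvable if one exists. A chamber $c$ is incident to $X\in L(\mathcal{A})$ if $\overline{c}\cap X$ spans $X$; $c_0$ is incident to the modular flag if it is incident to every $X_i$. $S(c,c')$ is the set of hyperplanes separating $c,c'$, $S(c)=S(c_0,c)$, and $\mathcal{P}(\mathcal{A},c_0)$ orders chambers by $c\le c'$ iff $S(c)\subseteq S(c')$; under the hypotheses this poset is a lattice with join $\vee$. $I$ is convex (w.r.t. $c_0$) if for each $H\in\mathcal{A}\setminus I$ there is a chamber $c$ with $H\in S(c)\subseteq\mathcal{A}\setminus I$; $I$ is 2-closed if for every $X\in L_2(\mathcal{A})$, $I\cap\mathcal{A}_X$ is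 convex in $\mathcal{A}_X=\{H:H\supseteq X\}$ with fundamental chamber the chamber of $\mathcal{A}_X$ containing $c_0$; $I$ is biclosed if $I$ and $\mathcal{A}\setminus I$ are 2-closed; the 2-closure of a set is the smallest 2-closed set containing it. *)

theory Defs
  imports "HOL-Algebra.Lattice" "HOL-Analysis.Analysis"
begin

definition codim :: "'a::euclidean_space set \<Rightarrow> nat" where
  "codim X = DIM('a) - dim X"

definition central_arrangement :: "'a::euclidean_space set set \<Rightarrow> bool" where
  "central_arrangement \<A> \<longleftrightarrow> finite \<A> \<and> (\<forall>H\<in>\<A>. subspace H \<and> codim H = 1)"

definition arrangement_rank :: "'a::euclidean_space set set \<Rightarrow> nat" where
  "arrangement_rank \<A> = codim (\<Inter>\<A>)"

definition chambers :: "'a::euclidean_space set set \<Rightarrow> 'a set set" where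
  "chambers \<A> = components (- \<Union>\<A>)"

text \<open>The empty subset contributes the whole space, since \<open>\<Inter>{} = UNIV\<close>.\<close>

definition intersection_lattice :: "'a::euclidean_space set set \<Rightarrow> 'a set set" where
  "intersection_lattice \<A> = {\<Inter>\<B> | \<B>. \<B> \<subseteq> \<A>}"

definition flats_of_codim :: "'a::euclidean_space set set \<Rightarrow> nat \<Rightarrow> 'a set set" where
  "flats_of_codim \<A> i = {X \<in> intersection_lattice \<A>. codim X = i}"

definition modular_flat :: "'a::euclidean_space set set \<Rightarrow> 'a set \<Rightarrow> bool" where
  "modular_flat \<A> X \<longleftrightarrow> X \<in> intersection_lattice \<A> \<and>
     (\<forall>Y\<in>intersection_lattice \<A>. {x + y | x y. x \<in> X \<and> y \<in> Y} \<in> intersection_lattice \<A>)"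

text \<open>The lattice is ordered by reverse inclusion, so an increasing chain of flats is a
  decreasing chain of subspaces. Only the values \<open>X 0, \<dots>, X r\<close> matter, \<open>r\<close> being the rank.\<close>

definition modular_flag :: "'a::euclidean_space set set \<Rightarrow> (nat \<Rightarrow> 'a set) \<Rightarrow> bool" where
  "modular_flag \<A> X \<longleftrightarrow>
     (\<forall>i\<le>arrangement_rank \<A>. X i \<in> flats_of_codim \<A> i \<and> modular_flat \<A> (X i)) \<and>
     (\<forall>i<arrangement_rank \<A>. X (Suc i) \<subset> X i)"

definition supersolvable :: "'a::euclidean_space set set \<Rightarrow> bool" where
  "supersolvable \<A> \<longleftrightarrow> (\<exists>X. modular_flag \<A> X)"

definition incident :: "'a::euclidean_space set \<Rightarrow> 'a set \<Rightarrow> bool" where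
  "incident c X \<longleftrightarrow> span (closure c \<inter> X) = X"

definition incident_flag ::
  "'a::euclidean_space set set \<Rightarrow> 'a set \<Rightarrow> (nat \<Rightarrow> 'a set) \<Rightarrow> bool" where
  "incident_flag \<A> c X \<longleftrightarrow> (\<forall>i\<le>arrangement_rank \<A>. incident c (X i))"

text \<open>\<open>H\<close> separates \<open>c\<close> and \<open>d\<close> if they lie in opposite open half-spaces bounded by \<open>H\<close>;
  the normal vector \<open>a\<close> may have either sign.\<close>

definition separation_set ::
  "'a::euclidean_space set set \<Rightarrow> 'a set \<Rightarrow> 'a set \<Rightarrow> 'a set set" where
  "separation_set \<A> c d =
     {H \<in> \<A>. \<exists>a. a \<noteq> 0 \<and> H = {x. a \<bullet> x = 0} \<and> (\<forall>x\<in>c. a \<bullet> x < 0) \<and> (\<forall>x\<in>d. a \<bullet> x > 0)}"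

definition chamber_poset :: "'a::euclidean_space set set \<Rightarrow> 'a set \<Rightarrow> 'a set gorder" where
  "chamber_poset \<A> c\<^sub>0 =
     \<lparr>carrier = chambers \<A>, eq = (=),
      le = (\<lambda>c d. separation_set \<A> c\<^sub>0 c \<subseteq> separation_set \<A> c\<^sub>0 d)\<rparr>"

definition convex_hyperplanes ::
  "'a::euclidean_space set set \<Rightarrow> 'a set \<Rightarrow> 'a set set \<Rightarrow> bool" where
  "convex_hyperplanes \<A> c\<^sub>0 I \<longleftrightarrow> I \<subseteq> \<A> \<and>
     (\<forall>H\<in>\<A> - I. \<exists>c\<in>chambers \<A>.
        H \<in> separation_set \<A> c\<^sub>0 c \<and> separation_set \<A> c\<^sub>0 c \<subseteq> \<A> - I)"

definition localization :: "'a::euclidean_space set set \<Rightarrow> 'a set \<Rightarrow> 'a set set" where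
  "localization \<A> X = {H \<in> \<A>. X \<subseteq> H}"

definition local_chamber :: "'a::euclidean_space set set \<Rightarrow> 'a set \<Rightarrow> 'a set \<Rightarrow> 'a set" where
  "local_chamber \<A> c\<^sub>0 X = (THE c. c \<in> chambers (localization \<A> X) \<and> c\<^sub>0 \<subseteq> c)"

definition two_closed :: "'a::euclidean_space set set \<Rightarrow> 'a set \<Rightarrow> 'a set set \<Rightarrow> bool" where
  "two_closed \<A> c\<^sub>0 I \<longleftrightarrow> I \<subseteq> \<A> \<and>
     (\<forall>X\<in>flats_of_codim \<A> 2.
        convex_hyperplanes (localization \<A> X) (local_chamber \<A> c\<^sub>0 X) (I \<inter> localization \<A> X))"

definition biclosed :: "'a::euclidean_space set set \<Rightarrow> 'a set \<Rightarrow> 'a set set \<Rightarrow> bool" where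
  "biclosed \<A> c\<^sub>0 I \<longleftrightarrow> two_closed \<A> c\<^sub>0 I \<and> two_closed \<A> c\<^sub>0 (\<A> - I)"

definition two_closure :: "'a::euclidean_space set set \<Rightarrow> 'a set \<Rightarrow> 'a set set \<Rightarrow> 'a set set" where
  "two_closure \<A> c\<^sub>0 I = two_closed \<A> c\<^sub>0 hull I"

text \<open>A \<open>hull\<close> is an intersection; the next facts confirm that here it is the
  smallest 2-closed set containing \<open>I\<close>.\<close>

lemma two_closed_Inter:
  assumes "\<F> \<noteq> {}" and "\<And>J. J \<in> \<F> \<Longrightarrow> two_closed \<A> c\<^sub>0 J"
  shows "two_closed \<A> c\<^sub>0 (\<Inter>\<F>)"
  unfolding two_closed_def
proof (intro conjI ballI)
  show "\<Inter>\<F> \<subseteq> \<A>"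
    using assms by (auto simp: two_closed_def)
next
  fix X assume X: "X \<in> flats_of_codim \<A> 2"
  show "convex_hyperplanes (localization \<A> X) (local_chamber \<A> c\<^sub>0 X) (\<Inter>\<F> \<inter> localization \<A> X)"
    unfolding convex_hyperplanes_def
  proof (intro conjI ballI)
    fix H assume "H \<in> localization \<A> X - \<Inter>\<F> \<inter> localization \<A> X"
    then obtain J where J: "J \<in> \<F>" "H \<in> localization \<A> X - J \<inter> localization \<A> X"
      by blast
    then obtain c where c: "c \<in> chambers (localization \<A> X)"
        "H \<in> separation_set (localization \<A> X) (local_chamber \<A> c\<^sub>0 X) c"
        "separation_set (localization \<A> X) (local_chamber \<A> c\<^sub>0 X) c
           \<subseteq> localization \<A> X - J \<inter> localization \<A> X"
      using assms(2)[OF J(1)] X unfolding two_closed_def convex_hyperplanes_def by meson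
    then show "\<exists>c\<in>chambers (localization \<A> X).
        H \<in> separation_set (localization \<A> X) (local_chamber \<A> c\<^sub>0 X) c \<and>
        separation_set (localization \<A> X) (local_chamber \<A> c\<^sub>0 X) c
          \<subseteq> localization \<A> X - \<Inter>\<F> \<inter> localization \<A> X"
      using J(1) by blast
  qed blast
qed

lemma two_closed_two_closure:
  assumes "I \<subseteq> \<A>"
  shows "two_closed \<A> c\<^sub>0 (two_closure \<A> c\<^sub>0 I)"
proof -
  have "two_closed \<A> c\<^sub>0 \<A>"
    by (auto simp: two_closed_def convex_hyperplanes_def localization_def)
  then show ?thesis
    using assms unfolding two_closure_def hull_def by (intro two_closed_Inter) auto
qed

lemma two_closure_superset: "I \<subseteq> two_closure \<A> c\<^sub>0 I"
  unfolding two_closure_def by (rule hull_subset)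

lemma two_closure_least: "two_closed \<A> c\<^sub>0 J \<Longrightarrow> I \<subseteq> J \<Longrightarrow> two_closure \<A> c\<^sub>0 I \<subseteq> J"
  unfolding two_closure_def by (rule hull_minimal)

end

theory Submission imports Defs begin

text \<open>Orient every normal to be positive on \<open>c\<^sub>0\<close>. Passing from the flag member \<open>X k\<close> to
  \<open>X (Suc k)\<close>, incidence gives a point \<open>v\<close> in the closure of \<open>c\<^sub>0\<close> which is killed by the normals of
  the hyperplanes through \<open>X k\<close> and positive on the new ones. Scaling the new normals to height 1 on
  \<open>v\<close>, modularity of \<open>X k\<close> makes the difference of any two a multiple of an old normal.

  Let \<open>K\<close> be 2-closed and contain sets \<open>I\<close> with 2-closed complements. Suppose \<open>x\<close> is such that the old
  hyperplanes with negative normal at \<open>x\<close> contain all old members of the \<open>I\<close>'s and lie in \<open>K\<close>. A new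
  hyperplane whose scaled value at \<open>x\<close> is below that of a member of \<open>I\<close> lies in \<open>I\<close> or in \<open>K\<close>, so
  moving \<open>x\<close> along \<open>v\<close> extends the property to the new hyperplanes. Hence some chamber has
  separation set between \<open>\<Union>I\<close> and \<open>K\<close>: take \<open>K = I\<close> for biclosed sets, and \<open>K\<close> the 2-closure of
  \<open>S(c) \<union> S(d)\<close> for joins.\<close>

section \<open>Preliminaries on linear forms and finite sets of reals\<close>

text \<open>The part \<open>z\<close> of \<open>g\<close> orthogonal to \<open>a\<close> and
  \<open>b\<close> is killed by both, hence by \<open>g\<close>; it is also orthogonal to
  \<open>y\<close>, so \<open>z \<bullet> z = g \<bullet> z - y \<bullet> z = 0\<close>.\<close>

lemma in_span_pair_if_vanishes:
  fixes a b g :: "'a::euclidean_space"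
  assumes "\<And>x. a \<bullet> x = 0 \<Longrightarrow> b \<bullet> x = 0 \<Longrightarrow> g \<bullet> x = 0"
  shows "\<exists>p q. g = p *\<^sub>R a + q *\<^sub>R b"
proof -
  obtain y z where yz: "y \<in> span {a, b}" "\<And>w. w \<in> span {a, b} \<Longrightarrow> orthogonal z w" "g = y + z"
    using orthogonal_subspace_decomp_exists[of "{a, b}" g] by blast
  have "orthogonal z a" "orthogonal z b" "orthogonal z y"
    using yz(1) by (auto intro!: yz(2) span_base)
  then have "g \<bullet> z = 0" "y \<bullet> z = 0"
    using assms[of z] by (auto simp: orthogonal_def inner_commute)
  then have "z = 0"
    using yz(3) by (simp add: inner_left_distrib)
  then have "g \<in> span {a, b}"
    using yz by simp
  then obtain p where "g - p *\<^sub>R a \<in> span {b}"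
    unfolding span_insert by blast
  then obtain q where "g - p *\<^sub>R a = q *\<^sub>R b"
    unfolding span_singleton by blast
  then have "g = p *\<^sub>R a + q *\<^sub>R b"
    by (simp add: algebra_simps)
  then show ?thesis
    by blast
qed

text \<open>\<open>E\<close> generates a down-set of \<open>T\<close> in the order of
  \<open>f\<close>-values, and a real number fits strictly between its values and the remaining
  ones. It will serve as the distance moved along \<open>v\<close>.\<close>

lemma finite_real_cut:
  fixes f :: "'b \<Rightarrow> real"
  assumes "finite T" and "E \<subseteq> T"
  shows "\<exists>t. \<forall>a\<in>T. f a \<noteq> t \<and> (f a < t \<longleftrightarrow> (\<exists>b\<in>E. f a \<le> f b))"
proof -
  define D where "D = {a \<in> T. \<exists>b\<in>E. f a \<le> f b}"
  have less: "f a < f u" if a: "a \<in> D" and u: "u \<in> T - D" for a u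
  proof (rule ccontr)
    assume "\<not> f a < f u"
    moreover obtain b where "b \<in> E" "f a \<le> f b" using a by (auto simp: D_def)
    ultimately have "f u \<le> f b" by linarith
    then show False using u \<open>b \<in> E\<close> by (auto simp: D_def)
  qed
  have fin: "finite (f ` D)" "finite (f ` (T - D))"
    using assms(1) by (auto simp: D_def)
  have "\<exists>t. (\<forall>a\<in>D. f a < t) \<and> (\<forall>u\<in>T - D. t < f u)"
  proof -
    consider "D = {}" | "T - D = {}" | "D \<noteq> {}" "T - D \<noteq> {}" by blast
    then show ?thesis
    proof cases
      case 1
      \<comment> \<open>With one side empty the cut lies beyond all values; inserting 0 keeps
        \<open>Min\<close>, and \<open>Max\<close> in the next case, meaningful when
        \<open>T\<close> is empty.\<close>
      have "\<forall>u\<in>T - D. Min (insert 0 (f ` (T - D))) - 1 < f u"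
        using fin by (smt (verit) Min_le finite_insert image_eqI insertI2)
      then show ?thesis using 1 by blast
    next
      case 2
      have "\<forall>a\<in>D. f a < Max (insert 0 (f ` D)) + 1"
        using fin by (smt (verit) Max_ge finite_insert image_eqI insertI2)
      then show ?thesis using 2 by blast
    next
      case 3
      have "Max (f ` D) < Min (f ` (T - D))"
        using 3 fin less by (subst Max_less_iff) (auto simp: Min_gr_iff)
      then obtain t where "Max (f ` D) < t" "t < Min (f ` (T - D))"
        using dense by blast
      then show ?thesis
        using fin 3 by (intro exI[of _ t]) auto
    qed
  qed
  then obtain t where t: "\<And>a. a \<in> D \<Longrightarrow> f a < t" "\<And>u. u \<in> T - D \<Longrightarrow> t < f u"
    by blast
  have "f a \<noteq> t \<and> (f a < t \<longleftrightarrow> (\<exists>b\<in>E. f a \<le> f b))" if "a \<in> T" for a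
  proof (cases "a \<in> D")
    case True
    then show ?thesis using t(1)[of a] by (auto simp: D_def)
  next
    case False
    then have "\<not> (\<exists>b\<in>E. f a \<le> f b)" using that by (simp add: D_def)
    then show ?thesis using t(2)[of a] that False by auto
  qed
  then show ?thesis by blast
qed

section \<open>Hyperplanes and chambers\<close>

lemma hyperplane_normal:
  fixes H :: "'a::euclidean_space set"
  assumes "subspace H" and "codim H = 1"
  obtains a where "a \<noteq> 0" and "H = {x. a \<bullet> x = 0}"
proof -
  have "dim H = DIM('a) - 1"
    using assms(2) unfolding codim_def by simp
  then obtain a where "a \<noteq> 0" "span H = {x. a \<bullet> x = 0}"
    by (rule lowdim_eq_hyperplane)
  then show thesis
    using that assms(1) by (simp add: span_eq_iff[THEN iffD2])
qed

text \<open>Distinct hyperplanes have equal dimension, so neither contains the other and their sum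
  is the whole space; the dimension formula does the rest.\<close>

lemma codim_Int_hyperplanes:
  fixes a b :: "'a::euclidean_space"
  assumes "a \<noteq> 0" and "b \<noteq> 0" and ne: "{x. a \<bullet> x = 0} \<noteq> {x. b \<bullet> x = 0}"
  shows "codim ({x. a \<bullet> x = 0} \<inter> {x. b \<bullet> x = 0}) = 2"
proof -
  let ?H = "{x. a \<bullet> x = 0}" and ?K = "{x. b \<bullet> x = 0}"
  let ?S = "{x + y |x y. x \<in> ?H \<and> y \<in> ?K}"
  have sub: "subspace ?H" "subspace ?K"
    by (auto intro: subspace_hyperplane)
  have dims: "dim ?H = DIM('a) - 1" "dim ?K = DIM('a) - 1"
    using assms by (auto simp: dim_hyperplane)
  have "\<not> ?K \<subseteq> ?H"
    using subspace_dim_equal[OF sub(2,1)] dims ne by auto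
  then obtain k where k: "b \<bullet> k = 0" "a \<bullet> k \<noteq> 0" by auto
  have "z \<in> ?S" for z
  proof -
    have "z = (z - (a \<bullet> z / (a \<bullet> k)) *\<^sub>R k) + (a \<bullet> z / (a \<bullet> k)) *\<^sub>R k" by simp
    moreover have "a \<bullet> (z - (a \<bullet> z / (a \<bullet> k)) *\<^sub>R k) = 0" "b \<bullet> ((a \<bullet> z / (a \<bullet> k)) *\<^sub>R k) = 0"
      using k by (simp_all add: inner_diff_right)
    ultimately show ?thesis by blast
  qed
  then have "?S = UNIV" by blast
  then have eq: "DIM('a) + dim (?H \<inter> ?K) = (DIM('a) - 1) + (DIM('a) - 1)"
    using dim_sums_Int[OF sub] dims by simp
  \<comment> \<open>Subtraction on \<open>nat\<close> truncates; positivity lets \<open>eq\<close>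
    be read as \<open>dim (?H \<inter> ?K) + 2 = DIM('a)\<close>.\<close>
  have "DIM('a) > 0" by simp
  with eq show ?thesis unfolding codim_def by linarith
qed

text \<open>By connectedness, a nonpositive value on \<open>c\<close> would force a zero on
  \<open>c\<close>, hence a point of \<open>c\<close> on a hyperplane of
  \<open>\<A>\<close>.\<close>

lemma chamber_sign_constant:
  fixes c :: "'a::euclidean_space set"
  assumes "c \<in> chambers \<A>" and "{x. a \<bullet> x = 0} \<in> \<A>" and "x \<in> c" and "y \<in> c" and "a \<bullet> x > 0"
  shows "a \<bullet> y > 0"
proof (rule ccontr)
  assume "\<not> a \<bullet> y > 0"
  moreover have "connected c"
    using assms(1) unfolding chambers_def by (rule in_components_connected)
  ultimately obtain z where "z \<in> c" "a \<bullet> z = 0"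
    using connected_ivt_hyperplane[of c y x a 0] assms(3-5) by force
  then show False
    using in_components_subset[OF assms(1)[unfolded chambers_def]] assms(2) by blast
qed

lemma chamber_nonempty: "c \<in> chambers \<A> \<Longrightarrow> c \<noteq> {}"
  unfolding chambers_def by (rule in_components_nonempty)

lemma chamber_disjoint: "c \<in> chambers \<A> \<Longrightarrow> H \<in> \<A> \<Longrightarrow> x \<in> c \<Longrightarrow> x \<notin> H"
  unfolding chambers_def using in_components_subset by blast

lemma chamber_through_point:
  assumes "\<And>H. H \<in> \<A> \<Longrightarrow> x \<notin> H"
  obtains c where "c \<in> chambers \<A>" and "x \<in> c"
  using assms Union_components[of "- \<Union>\<A>"] unfolding chambers_def by blast

text \<open>The description in \<open>local_chamber\<close> is proper: \<open>c\<^sub>0\<close> is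
  connected and avoids the localized hyperplanes, so some component contains it, and overlapping
  components coincide.\<close>

lemma local_chamber_works:
  assumes "c\<^sub>0 \<in> chambers \<A>"
  shows "local_chamber \<A> c\<^sub>0 X \<in> chambers (localization \<A> X) \<and> c\<^sub>0 \<subseteq> local_chamber \<A> c\<^sub>0 X"
  unfolding local_chamber_def
proof (rule theI')
  have ne: "c\<^sub>0 \<noteq> {}" using assms by (rule chamber_nonempty)
  have "connected c\<^sub>0" "c\<^sub>0 \<subseteq> - \<Union>\<A>"
    using assms unfolding chambers_def
    by (auto dest: in_components_connected in_components_subset)
  then have "connected c\<^sub>0" "c\<^sub>0 \<subseteq> - \<Union>(localization \<A> X)"
    by (auto simp: localization_def)
  then obtain c where "c \<in> chambers (localization \<A> X)" "c\<^sub>0 \<subseteq> c"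
    using exists_component_superset ne unfolding chambers_def by (metis subset_empty)
  moreover have "d = c" if "d \<in> chambers (localization \<A> X)" "c\<^sub>0 \<subseteq> d" for d
    using that calculation ne components_nonoverlap[of d _ c] unfolding chambers_def by blast
  ultimately show "\<exists>!c. c \<in> chambers (localization \<A> X) \<and> c\<^sub>0 \<subseteq> c"
    by blast
qed

section \<open>Separation sets as sign conditions\<close>

text \<open>With normals positive on \<open>c\<^sub>0\<close>, separation of
  \<open>c\<^sub>0\<close> from the chamber of \<open>x\<close> by \<open>H\<close> becomes the
  single test \<open>n H \<bullet> x < 0\<close>.\<close>

locale oriented_arrangement =
  fixes \<A> :: "'a::euclidean_space set set" and c\<^sub>0 :: "'a set" and n :: "'a set \<Rightarrow> 'a"
  assumes finite_arrangement: "finite \<A>"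
    and chamber: "c\<^sub>0 \<in> chambers \<A>"
    and normal: "H \<in> \<A> \<Longrightarrow> H = {x. n H \<bullet> x = 0}"
    and positive: "H \<in> \<A> \<Longrightarrow> x \<in> c\<^sub>0 \<Longrightarrow> n H \<bullet> x > 0"
begin

lemma in_hyperplane_iff: "H \<in> \<A> \<Longrightarrow> x \<in> H \<longleftrightarrow> n H \<bullet> x = 0"
  using normal by blast

lemma normal_nonzero: "H \<in> \<A> \<Longrightarrow> n H \<noteq> 0"
  using chamber_nonempty[OF chamber] positive by fastforce

lemma separation_set_eq:
  assumes c: "c \<in> chambers \<A>" and x: "x \<in> c"
  shows "separation_set \<A> c\<^sub>0 c = {H \<in> \<A>. n H \<bullet> x < 0}"
proof (intro Set.set_eqI iffI)
  fix H assume "H \<in> separation_set \<A> c\<^sub>0 c"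
  then obtain a where H: "H \<in> \<A>" and a: "H = {x. a \<bullet> x = 0}" "\<forall>y\<in>c\<^sub>0. a \<bullet> y < 0" "a \<bullet> x > 0"
    using x unfolding separation_set_def by blast
  obtain p where p: "p \<in> c\<^sub>0" using chamber_nonempty[OF chamber] by blast
  have "n H \<bullet> x < 0"
  proof (rule ccontr)
    assume nx: "\<not> n H \<bullet> x < 0"
    \<comment> \<open>\<open>z\<close> is the combination of \<open>p\<close> and \<open>x\<close>
      with the positive coefficients \<open>a \<bullet> x\<close> and
      \<open>- (a \<bullet> p)\<close> that lies on \<open>H\<close>. So \<open>n H\<close> vanishes
      at \<open>z\<close>, although it is positive at \<open>p\<close> and, by assumption,
      nonnegative at \<open>x\<close>.\<close>
    define z where "z = (a \<bullet> x) *\<^sub>R p - (a \<bullet> p) *\<^sub>R x"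
    have "a \<bullet> z = 0" by (simp add: z_def inner_diff_right)
    then have "n H \<bullet> z = 0" using H a(1) in_hyperplane_iff by blast
    moreover have "(a \<bullet> x) * (n H \<bullet> p) > 0" "(- (a \<bullet> p)) * (n H \<bullet> x) \<ge> 0"
      using a p nx positive[OF H p]
      by (force intro: mult_pos_pos, intro mult_nonneg_nonneg) (force simp: less_imp_le)+
    ultimately show False by (simp add: z_def inner_diff_right)
  qed
  then show "H \<in> {H \<in> \<A>. n H \<bullet> x < 0}" using H by simp
next
  fix H assume "H \<in> {H \<in> \<A>. n H \<bullet> x < 0}"
  then have H: "H \<in> \<A>" "n H \<bullet> x < 0" by auto
  \<comment> \<open>\<open>separation_set\<close> asks for a normal that is negative on
    \<open>c\<^sub>0\<close>, hence the reversed sign.\<close>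
  have eq: "H = {y. - n H \<bullet> y = 0}" using normal[OF H(1)] by simp
  have "\<forall>y\<in>c. - n H \<bullet> y > 0"
  proof
    fix y assume "y \<in> c"
    then show "- n H \<bullet> y > 0"
      using chamber_sign_constant[OF c _ x, of "- n H" y] eq H by simp
  qed
  moreover have "\<forall>y\<in>c\<^sub>0. - n H \<bullet> y < 0"
    using positive H by simp
  ultimately show "H \<in> separation_set \<A> c\<^sub>0 c"
    unfolding separation_set_def using eq H normal_nonzero
    by (intro CollectI conjI exI[of _ "- n H"]) auto
qed

section \<open>Localizations and 2-closed sets\<close>

text \<open>The same normals serve every localization, so local separation sets are sign conditions
  too; positivity spreads from \<open>c\<^sub>0\<close> to the local chamber by constancy of
  sign.\<close>

lemma oriented_localization: "oriented_arrangement (localization \<A> X) (local_chamber \<A> c\<^sub>0 X) n"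
proof
  have loc: "local_chamber \<A> c\<^sub>0 X \<in> chambers (localization \<A> X)"
    "c\<^sub>0 \<subseteq> local_chamber \<A> c\<^sub>0 X"
    using local_chamber_works[OF chamber] by auto
  show "finite (localization \<A> X)"
    using finite_arrangement by (simp add: localization_def)
  show "local_chamber \<A> c\<^sub>0 X \<in> chambers (localization \<A> X)"
    by (rule loc)
  show "H = {x. n H \<bullet> x = 0}" if "H \<in> localization \<A> X" for H
    using that normal by (simp add: localization_def)
  show "n H \<bullet> x > 0" if H: "H \<in> localization \<A> X" and "x \<in> local_chamber \<A> c\<^sub>0 X" for H x
  proof -
    obtain p where p: "p \<in> c\<^sub>0" using chamber_nonempty[OF chamber] by blast
    have "H \<in> \<A>" using H by (simp add: localization_def)
    then have "{x. n H \<bullet> x = 0} \<in> localization \<A> X" "n H \<bullet> p > 0"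
      using H p normal[of H] positive by auto
    then show ?thesis
      using chamber_sign_constant[OF loc(1)] loc(2) p that(2) by blast
  qed
qed

text \<open>On the rank-two flat \<open>B \<inter> C\<close>, any local chamber beyond \<open>D\<close> is also beyond \<open>B\<close> or \<open>C\<close>.\<close>

lemma two_closed_combination:
  assumes K: "two_closed \<A> c\<^sub>0 K" and BC: "B \<in> K" "C \<in> K" and D: "D \<in> \<A>"
    and comb: "n D = p *\<^sub>R n B + q *\<^sub>R n C" and pq: "p > 0" "q > 0"
  shows "D \<in> K"
proof (rule ccontr)
  assume "D \<notin> K"
  have BCA: "B \<in> \<A>" "C \<in> \<A>"
    using K BC by (auto simp: two_closed_def)
  define X where "X = B \<inter> C"
  have "B \<noteq> C"
  proof
    assume "B = C"
    then have "n D = (p + q) *\<^sub>R n B" using comb by (simp add: scaleR_add_left)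
    then have "D = B"
      using normal[OF D] normal[OF BCA(1)] pq by auto
    then show False using \<open>D \<notin> K\<close> BC by simp
  qed
  then have "codim X = 2"
    using codim_Int_hyperplanes[of "n B" "n C"] normal[OF BCA(1)] normal[OF BCA(2)]
      normal_nonzero BCA by (metis X_def)
  moreover have "X \<in> intersection_lattice \<A>"
    unfolding intersection_lattice_def X_def using BCA by (intro CollectI exI[of _ "{B, C}"]) auto
  ultimately have X: "X \<in> flats_of_codim \<A> 2"
    by (simp add: flats_of_codim_def)
  have locs: "B \<in> localization \<A> X" "C \<in> localization \<A> X" "D \<in> localization \<A> X"
    using BCA D comb in_hyperplane_iff
    by (auto simp: localization_def X_def inner_add_left)
  then obtain c where c: "c \<in> chambers (localization \<A> X)"
    "D \<in> separation_set (localization \<A> X) (local_chamber \<A> c\<^sub>0 X) c"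
    "separation_set (localization \<A> X) (local_chamber \<A> c\<^sub>0 X) c
       \<subseteq> localization \<A> X - K \<inter> localization \<A> X"
    using K X \<open>D \<notin> K\<close> unfolding two_closed_def convex_hyperplanes_def by blast
  obtain x where x: "x \<in> c" using chamber_nonempty[OF c(1)] by blast
  note sep = oriented_arrangement.separation_set_eq[OF oriented_localization c(1) x]
  have "n B \<bullet> x \<ge> 0" "n C \<bullet> x \<ge> 0"
    using c(3) locs BC unfolding sep by force+
  then have "n D \<bullet> x \<ge> 0"
    using comb pq by (simp add: inner_add_left)
  then show False using c(2) unfolding sep by simp
qed

text \<open>The local chamber containing \<open>- x\<close> is separated from the fundamental one by
  exactly the localized hyperplanes outside the set, so this one chamber witnesses convexity for all
  of them.\<close>

lemma two_closed_negative:
  assumes "\<And>H. H \<in> \<A> \<Longrightarrow> n H \<bullet> x \<noteq> 0"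
  shows "two_closed \<A> c\<^sub>0 {H \<in> \<A>. n H \<bullet> x < 0}"
  unfolding two_closed_def convex_hyperplanes_def
proof (intro conjI ballI)
  fix X H
  let ?L = "localization \<A> X" and ?I = "{H \<in> \<A>. n H \<bullet> x < 0}"
  assume H: "H \<in> ?L - ?I \<inter> ?L"
  have LA: "?L \<subseteq> \<A>" by (auto simp: localization_def)
  then have "\<And>H. H \<in> ?L \<Longrightarrow> - x \<notin> H"
    using assms in_hyperplane_iff by auto
  then obtain c where c: "c \<in> chambers ?L" "- x \<in> c"
    using chamber_through_point by blast
  have "separation_set ?L (local_chamber \<A> c\<^sub>0 X) c = {H \<in> ?L. n H \<bullet> x > 0}"
    using oriented_arrangement.separation_set_eq[OF oriented_localization c] by simp
  then show "\<exists>c\<in>chambers ?L. H \<in> separation_set ?L (local_chamber \<A> c\<^sub>0 X) c \<and>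
      separation_set ?L (local_chamber \<A> c\<^sub>0 X) c \<subseteq> ?L - ?I \<inter> ?L"
    using H LA assms c(1) by (intro bexI[of _ c]) fastforce+
qed auto

lemma two_closed_nonnegative:
  assumes "\<And>H. H \<in> \<A> \<Longrightarrow> n H \<bullet> x \<noteq> 0"
  shows "two_closed \<A> c\<^sub>0 (\<A> - {H \<in> \<A>. n H \<bullet> x < 0})"
proof -
  have "\<A> - {H \<in> \<A>. n H \<bullet> x < 0} = {H \<in> \<A>. n H \<bullet> (- x) < 0}"
    using assms by force
  then show ?thesis
    using two_closed_negative[of "- x"] assms by simp
qed

lemma separation_set_biclosed:
  assumes "c \<in> chambers \<A>"
  shows "biclosed \<A> c\<^sub>0 (separation_set \<A> c\<^sub>0 c)"
proof -
  obtain x where x: "x \<in> c" using chamber_nonempty[OF assms] by blast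
  then have "\<And>H. H \<in> \<A> \<Longrightarrow> n H \<bullet> x \<noteq> 0"
    using chamber_disjoint[OF assms] in_hyperplane_iff by blast
  then show ?thesis
    unfolding biclosed_def separation_set_eq[OF assms x]
    using two_closed_negative two_closed_nonnegative by blast
qed

section \<open>Descent along the modular flag\<close>

text \<open>\<open>v\<close> and \<open>X (Suc k)\<close> together span \<open>X k\<close>. The old
  hyperplane \<open>G\<close> arises from the flat \<open>X k + (H \<inter> K)\<close>, which is
  proper because the difference of the two scaled normals vanishes on it.\<close>

lemma modular_step:
  assumes flag: "modular_flag \<A> X" "incident_flag \<A> c\<^sub>0 X" and k: "k < arrangement_rank \<A>"
  obtains v where
    "\<And>H. H \<in> \<A> \<Longrightarrow> X k \<subseteq> H \<Longrightarrow> n H \<bullet> v = 0"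
    "\<And>H. H \<in> \<A> \<Longrightarrow> X (Suc k) \<subseteq> H \<Longrightarrow> \<not> X k \<subseteq> H \<Longrightarrow> n H \<bullet> v > 0"
    "\<And>H K. H \<in> \<A> \<Longrightarrow> X (Suc k) \<subseteq> H \<Longrightarrow> \<not> X k \<subseteq> H \<Longrightarrow>
       K \<in> \<A> \<Longrightarrow> X (Suc k) \<subseteq> K \<Longrightarrow> \<not> X k \<subseteq> K \<Longrightarrow> H \<noteq> K \<Longrightarrow>
       \<exists>G\<in>\<A>. X k \<subseteq> G \<and> (\<exists>p. p \<noteq> 0 \<and>
         n H /\<^sub>R (n H \<bullet> v) = n K /\<^sub>R (n K \<bullet> v) + p *\<^sub>R n G)"
proof -
  have flats: "X k \<in> flats_of_codim \<A> k" "X (Suc k) \<in> flats_of_codim \<A> (Suc k)"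
    and mod: "modular_flat \<A> (X k)" and sub: "X (Suc k) \<subset> X k"
    and inc: "span (closure c\<^sub>0 \<inter> X k) = X k"
    using flag k unfolding modular_flag_def incident_flag_def incident_def by auto
  have "subspace Y" if "Y \<in> intersection_lattice \<A>" for Y
  proof -
    have "subspace H" if "H \<in> \<A>" for H
      using normal[OF that] subspace_hyperplane[of "n H"] by simp
    then show ?thesis
      using that unfolding intersection_lattice_def by (auto intro!: subspace_Inter)
  qed
  then have sp: "subspace (X k)" "subspace (X (Suc k))"
    using flats by (auto simp: flats_of_codim_def)
  \<comment> \<open>Otherwise the span of \<open>closure c\<^sub>0 \<inter> X k\<close>, which is
    \<open>X k\<close> by incidence, would lie in the strictly smaller
    \<open>X (Suc k)\<close>.\<close>
  have "\<not> closure c\<^sub>0 \<inter> X k \<subseteq> X (Suc k)"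
    using span_minimal[OF _ sp(2)] inc sub by blast
  then obtain v where v: "v \<in> closure c\<^sub>0" "v \<in> X k" "v \<notin> X (Suc k)"
    by blast
  have span_v: "span (insert v (X (Suc k))) = X k"
  proof (rule subspace_dim_equal)
    show "subspace (span (insert v (X (Suc k))))" by simp
    show "span (insert v (X (Suc k))) \<subseteq> X k"
      using v sub sp by (intro span_minimal) auto
    have "dim (insert v (X (Suc k))) = Suc (dim (X (Suc k)))"
      using v sp by (simp add: dim_insert span_eq_iff[THEN iffD2])
    then show "dim (X k) \<le> dim (span (insert v (X (Suc k))))"
      using flats dim_subset_UNIV[of "X k"] by (auto simp: flats_of_codim_def codim_def)
  qed (rule sp)
  have zero: "n H \<bullet> v = 0" if "H \<in> \<A>" "X k \<subseteq> H" for H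
    using that v in_hyperplane_iff by blast
  have pos: "n H \<bullet> v > 0" if H: "H \<in> \<A>" "X (Suc k) \<subseteq> H" "\<not> X k \<subseteq> H" for H
  proof -
    have "closure c\<^sub>0 \<subseteq> {x. n H \<bullet> x \<ge> 0}"
      using positive[OF H(1)] by (intro closure_minimal closed_halfspace_ge) force
    then have "n H \<bullet> v \<ge> 0" using v by blast
    moreover have "n H \<bullet> v \<noteq> 0"
    proof
      assume "n H \<bullet> v = 0"
      then have "insert v (X (Suc k)) \<subseteq> H"
        using H in_hyperplane_iff by blast
      moreover have "subspace H"
        using normal[OF H(1)] subspace_hyperplane[of "n H"] by simp
      ultimately have "X k \<subseteq> H" using span_minimal span_v by blast
      then show False using H by blast
    qed
    ultimately show ?thesis by simp
  qed
  have diff: "\<exists>G\<in>\<A>. X k \<subseteq> G \<and> (\<exists>p. p \<noteq> 0 \<and>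
         n H /\<^sub>R (n H \<bullet> v) = n K /\<^sub>R (n K \<bullet> v) + p *\<^sub>R n G)"
    if H: "H \<in> \<A>" "X (Suc k) \<subseteq> H" "\<not> X k \<subseteq> H"
      and K: "K \<in> \<A>" "X (Suc k) \<subseteq> K" "\<not> X k \<subseteq> K" and "H \<noteq> K" for H K
  proof -
    let ?h = "n H /\<^sub>R (n H \<bullet> v)" and ?k = "n K /\<^sub>R (n K \<bullet> v)"
    let ?Z = "{x + y |x y. x \<in> X k \<and> y \<in> H \<inter> K}"
    have hv: "?h \<bullet> v = 1" "?k \<bullet> v = 1"
      using pos[OF H] pos[OF K] by auto
    have hH: "?h \<bullet> x = 0 \<longleftrightarrow> x \<in> H" and kK: "?k \<bullet> x = 0 \<longleftrightarrow> x \<in> K" for x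
      using pos[OF H] pos[OF K] in_hyperplane_iff H K by auto
    have "?h \<noteq> ?k" using hH kK \<open>H \<noteq> K\<close> by (metis Set.set_eqI)
    have HK: "H \<inter> K \<subseteq> {x. (?h - ?k) \<bullet> x = 0}"
    proof
      fix x assume "x \<in> H \<inter> K"
      then have "?h \<bullet> x = 0" "?k \<bullet> x = 0" using hH kK by blast+
      then show "x \<in> {x. (?h - ?k) \<bullet> x = 0}"
        by (simp only: inner_diff_left mem_Collect_eq diff_self)
    qed
    moreover have "(?h - ?k) \<bullet> v = 0" using hv by (simp only: inner_diff_left diff_self)
    ultimately have "insert v (X (Suc k)) \<subseteq> {x. (?h - ?k) \<bullet> x = 0}"
      using H(2) K(2) by blast
    then have vanish: "X k \<subseteq> {x. (?h - ?k) \<bullet> x = 0}"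
      using span_minimal[OF _ subspace_hyperplane] span_v by metis
    have "?Z \<subseteq> {x. (?h - ?k) \<bullet> x = 0}"
    proof
      fix z assume "z \<in> ?Z"
      then obtain x y where "z = x + y" "(?h - ?k) \<bullet> x = 0" "(?h - ?k) \<bullet> y = 0"
        using vanish HK by blast
      then show "z \<in> {x. (?h - ?k) \<bullet> x = 0}"
        by (simp only: inner_add_right mem_Collect_eq add_0)
    qed
    \<comment> \<open>A nonzero vector is not orthogonal to itself, so the sum \<open>?Z\<close>
      misses it.\<close>
    moreover have "?h - ?k \<notin> {x. (?h - ?k) \<bullet> x = 0}"
      using \<open>?h \<noteq> ?k\<close> by simp
    ultimately have "?Z \<noteq> UNIV" by blast
    have "H \<inter> K \<in> intersection_lattice \<A>"
      unfolding intersection_lattice_def using H K by (intro CollectI exI[of _ "{H, K}"]) auto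
    then have "?Z \<in> intersection_lattice \<A>"
      using mod unfolding modular_flat_def by blast
    \<comment> \<open>A flat other than the whole space is the intersection of a nonempty family, so
      some hyperplane contains it.\<close>
    then obtain G where G: "G \<in> \<A>" "?Z \<subseteq> G"
      using \<open>?Z \<noteq> UNIV\<close> unfolding intersection_lattice_def by blast
    have "0 \<in> X k" "0 \<in> H \<inter> K"
      using sp hH[of 0] kK[of 0] by (auto simp: subspace_0)
    then have XG: "X k \<subseteq> G" and HKG: "H \<inter> K \<subseteq> G"
      using G(2) by force+
    have "\<exists>p q. n G = p *\<^sub>R ?h + q *\<^sub>R ?k"
      using in_span_pair_if_vanishes[of ?h ?k "n G"] HKG hH kK in_hyperplane_iff[OF G(1)] by blast
    then obtain p q where pq: "n G = p *\<^sub>R ?h + q *\<^sub>R ?k" by blast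
    \<comment> \<open>At \<open>v\<close> the normal of \<open>G\<close> vanishes, since
      \<open>v\<close> lies in \<open>X k\<close>, and both scaled normals take the value 1; hence
      \<open>p + q = 0\<close>.\<close>
    have "n G \<bullet> v = p * (?h \<bullet> v) + q * (?k \<bullet> v)"
      unfolding pq by (simp only: inner_add_left inner_scaleR_left)
    then have "q = - p"
      using hv zero[OF G(1) XG] by simp
    then have nG: "n G = p *\<^sub>R (?h - ?k)" using pq by (simp add: algebra_simps)
    then have "p \<noteq> 0" using normal_nonzero[OF G(1)] by auto
    then have "?h = ?k + (1 / p) *\<^sub>R n G" unfolding nG by simp
    then show ?thesis using G(1) XG \<open>p \<noteq> 0\<close> by (intro bexI[of _ G] conjI exI[of _ "1 / p"]) auto
  qed
  from zero pos diff show thesis by (rule that)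
qed

text \<open>Moving \<open>x\<close> by \<open>- t *\<^sub>R v\<close> keeps the old values and
  lowers every scaled new value \<open>f H\<close> by the same \<open>t\<close>. So only the
  position of the cut \<open>t\<close> is to be chosen: just above the values of the new members of
  \<open>\<Union>\<I>\<close>.\<close>

lemma separating_point_step:
  assumes I: "\<And>I. I \<in> \<I> \<Longrightarrow> I \<subseteq> K \<and> two_closed \<A> c\<^sub>0 (\<A> - I)" and K: "two_closed \<A> c\<^sub>0 K"
    and flag: "modular_flag \<A> X" "incident_flag \<A> c\<^sub>0 X" and k: "k < arrangement_rank \<A>"
    and x: "\<And>H. H \<in> \<A> \<Longrightarrow> X k \<subseteq> H \<Longrightarrow> n H \<bullet> x \<noteq> 0"
    and inc: "\<And>H. H \<in> \<Union>\<I> \<Longrightarrow> X k \<subseteq> H \<Longrightarrow> n H \<bullet> x < 0"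
    and neg: "\<And>H. H \<in> \<A> \<Longrightarrow> X k \<subseteq> H \<Longrightarrow> n H \<bullet> x < 0 \<Longrightarrow> H \<in> K"
  shows "\<exists>y. \<forall>H\<in>\<A>. X (Suc k) \<subseteq> H \<longrightarrow>
    n H \<bullet> y \<noteq> 0 \<and> (H \<in> \<Union>\<I> \<longrightarrow> n H \<bullet> y < 0) \<and> (n H \<bullet> y < 0 \<longrightarrow> H \<in> K)"
proof -
  obtain v where zero: "\<And>H. H \<in> \<A> \<Longrightarrow> X k \<subseteq> H \<Longrightarrow> n H \<bullet> v = 0"
    and pos: "\<And>H. H \<in> \<A> \<Longrightarrow> X (Suc k) \<subseteq> H \<Longrightarrow> \<not> X k \<subseteq> H \<Longrightarrow> n H \<bullet> v > 0"
    and diff: "\<And>H K. H \<in> \<A> \<Longrightarrow> X (Suc k) \<subseteq> H \<Longrightarrow> \<not> X k \<subseteq> H \<Longrightarrow>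
       K \<in> \<A> \<Longrightarrow> X (Suc k) \<subseteq> K \<Longrightarrow> \<not> X k \<subseteq> K \<Longrightarrow> H \<noteq> K \<Longrightarrow>
       \<exists>G\<in>\<A>. X k \<subseteq> G \<and> (\<exists>p. p \<noteq> 0 \<and>
         n H /\<^sub>R (n H \<bullet> v) = n K /\<^sub>R (n K \<bullet> v) + p *\<^sub>R n G)"
    using modular_step[OF flag k] by blast
  define T where "T = {H \<in> \<A>. X (Suc k) \<subseteq> H \<and> \<not> X k \<subseteq> H}"
  define f where "f H = (n H \<bullet> x) / (n H \<bullet> v)" for H
  have "finite T" "T \<inter> \<Union>\<I> \<subseteq> T" using finite_arrangement by (auto simp: T_def)
  then obtain t where t: "\<And>H. H \<in> T \<Longrightarrow> f H \<noteq> t"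
      "\<And>H. H \<in> T \<Longrightarrow> f H < t \<longleftrightarrow> (\<exists>B\<in>T \<inter> \<Union>\<I>. f H \<le> f B)"
    using finite_real_cut[of T "T \<inter> \<Union>\<I>" f] by blast
  \<comment> \<open>For \<open>H \<noteq> B\<close>,
    \<open>f H - f B = p * (n G \<bullet> x)\<close> is strictly negative, both factors being
    nonzero. If \<open>p > 0\<close>, then \<open>G\<close> is in \<open>K\<close> and
    \<open>n H\<close> is a positive combination of \<open>n B\<close> and \<open>n G\<close>. If
    \<open>p < 0\<close>, then \<open>G\<close> is outside \<open>I\<close> and \<open>n B\<close>
    is a positive combination of \<open>n H\<close> and \<open>n G\<close>, so \<open>H\<close>
    outside \<open>I\<close> would force \<open>B\<close> outside \<open>I\<close>.\<close>
  have below: "H \<in> K" if H: "H \<in> T" and B: "B \<in> T" "B \<in> I" "I \<in> \<I>" and le: "f H \<le> f B" for H B I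
  proof (cases "H = B")
    case True
    then show ?thesis using I B by blast
  next
    case False
    have HA: "H \<in> \<A>" and BA: "B \<in> \<A>" and hpos: "n H \<bullet> v > 0" and bpos: "n B \<bullet> v > 0"
      using H B pos by (auto simp: T_def)
    obtain G p where G: "G \<in> \<A>" "X k \<subseteq> G" and p: "p \<noteq> 0"
      and eq: "n H /\<^sub>R (n H \<bullet> v) = n B /\<^sub>R (n B \<bullet> v) + p *\<^sub>R n G"
      using diff[of H B] H B False unfolding T_def by blast
    have "f H = f B + p * (n G \<bullet> x)"
      using arg_cong[OF eq, of "\<lambda>u. u \<bullet> x"] by (simp add: f_def inner_add_left divide_inverse_commute)
    then have sgn: "p * (n G \<bullet> x) < 0"
      using le p x[OF G] by (simp add: order_less_le)
    show ?thesis
    proof (cases "p > 0")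
      case True
      then have "G \<in> K" using neg[OF G] sgn by (simp add: mult_less_0_iff)
      have "n H = (n H \<bullet> v) *\<^sub>R (n H /\<^sub>R (n H \<bullet> v))" using hpos by simp
      also have "\<dots> = ((n H \<bullet> v) / (n B \<bullet> v)) *\<^sub>R n B + ((n H \<bullet> v) * p) *\<^sub>R n G"
        unfolding eq by (simp add: scaleR_add_right divide_inverse)
      finally have "n H = \<dots>" .
      moreover have "B \<in> K" using B I by blast
      ultimately show ?thesis
        using two_closed_combination[OF K _ \<open>G \<in> K\<close> HA] hpos bpos True
        by (metis divide_pos_pos mult_pos_pos)
    next
      case False
      then have p': "- p > 0" using p by simp
      have "n G \<bullet> x > 0" using sgn False by (simp add: mult_less_0_iff)
      then have "G \<in> \<A> - I" using inc G B by fastforce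
      have "H \<in> I"
      proof (rule ccontr)
        assume "H \<notin> I"
        have "n B /\<^sub>R (n B \<bullet> v) = n H /\<^sub>R (n H \<bullet> v) + (- p) *\<^sub>R n G"
          using eq by simp
        moreover have "n B = (n B \<bullet> v) *\<^sub>R (n B /\<^sub>R (n B \<bullet> v))" using bpos by simp
        ultimately have "n B = (n B \<bullet> v) *\<^sub>R (n H /\<^sub>R (n H \<bullet> v) + (- p) *\<^sub>R n G)"
          by simp
        also have "\<dots> = ((n B \<bullet> v) / (n H \<bullet> v)) *\<^sub>R n H + ((n B \<bullet> v) * (- p)) *\<^sub>R n G"
          by (simp only: scaleR_add_right divide_inverse scaleR_scaleR)
        finally have "B \<in> \<A> - I"
          using two_closed_combination[of "\<A> - I" H G B] I B \<open>G \<in> \<A> - I\<close> \<open>H \<notin> I\<close>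
            HA BA hpos bpos p' by (metis DiffI divide_pos_pos mult_pos_pos)
        then show False using B by blast
      qed
      then show ?thesis using I B by blast
    qed
  qed
  define y where "y = x - t *\<^sub>R v"
  have old: "n H \<bullet> y = n H \<bullet> x" if "H \<in> \<A>" "X k \<subseteq> H" for H
    using zero[OF that] by (simp add: y_def inner_diff_right)
  have new: "n H \<bullet> y = (n H \<bullet> v) * (f H - t)" "n H \<bullet> v > 0" if "H \<in> T" for H
    using that pos[of H] by (auto simp: y_def inner_diff_right f_def T_def field_simps)
  have "n H \<bullet> y \<noteq> 0 \<and> (H \<in> \<Union>\<I> \<longrightarrow> n H \<bullet> y < 0) \<and> (n H \<bullet> y < 0 \<longrightarrow> H \<in> K)"
    if H: "H \<in> \<A>" "X (Suc k) \<subseteq> H" for H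
  proof (cases "X k \<subseteq> H")
    case True
    then show ?thesis using old x inc neg H by simp
  next
    case False
    then have HT: "H \<in> T" using H by (simp add: T_def)
    have "n H \<bullet> y < 0 \<longleftrightarrow> f H < t" "n H \<bullet> y \<noteq> 0"
      using new[OF HT] t(1)[OF HT] by (auto simp: mult_less_0_iff)
    then show ?thesis using t(2)[OF HT] HT below by blast
  qed
  then show ?thesis by blast
qed

lemma separating_point:
  assumes I: "\<And>I. I \<in> \<I> \<Longrightarrow> I \<subseteq> K \<and> two_closed \<A> c\<^sub>0 (\<A> - I)" and K: "two_closed \<A> c\<^sub>0 K"
    and flag: "modular_flag \<A> X" "incident_flag \<A> c\<^sub>0 X" and k: "k \<le> arrangement_rank \<A>"
  shows "\<exists>x. \<forall>H\<in>\<A>. X k \<subseteq> H \<longrightarrow>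
    n H \<bullet> x \<noteq> 0 \<and> (H \<in> \<Union>\<I> \<longrightarrow> n H \<bullet> x < 0) \<and> (n H \<bullet> x < 0 \<longrightarrow> H \<in> K)"
  using k
proof (induction k)
  case 0
  \<comment> \<open>\<open>X 0\<close> has codimension 0, so no hyperplane contains it and the claim
    is vacuous.\<close>
  have "\<not> X 0 \<subseteq> H" if H: "H \<in> \<A>" for H
  proof
    assume "X 0 \<subseteq> H"
    moreover have "H = {x. n H \<bullet> x = 0}" using normal[OF H] .
    ultimately have "dim (X 0) \<le> dim {x. n H \<bullet> x = 0}" by (metis dim_subset)
    also have "\<dots> = DIM('a) - 1" using normal_nonzero[OF H] by (simp add: dim_hyperplane)
    also have "\<dots> < DIM('a)" by simp
    finally have "codim (X 0) > 0" by (simp add: codim_def)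
    then show False
      using flag unfolding modular_flag_def flats_of_codim_def by auto
  qed
  then show ?case by blast
next
  case (Suc k)
  then obtain x where x: "\<forall>H\<in>\<A>. X k \<subseteq> H \<longrightarrow>
      n H \<bullet> x \<noteq> 0 \<and> (H \<in> \<Union>\<I> \<longrightarrow> n H \<bullet> x < 0) \<and> (n H \<bullet> x < 0 \<longrightarrow> H \<in> K)"
    by auto
  have KA: "K \<subseteq> \<A>" using K by (simp add: two_closed_def)
  have "k < arrangement_rank \<A>" using Suc by simp
  with I K flag show ?case
    by (rule separating_point_step) (use x I KA in blast)+
qed

text \<open>At the end of the flag the sign conditions concern all of \<open>\<A>\<close>, so the
  point found lies in a chamber. The family \<open>\<I>\<close> will have one member for biclosed
  sets and two for joins.\<close>

lemma separating_chamber: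
  assumes I: "\<And>I. I \<in> \<I> \<Longrightarrow> I \<subseteq> K \<and> two_closed \<A> c\<^sub>0 (\<A> - I)" and K: "two_closed \<A> c\<^sub>0 K"
    and flag: "modular_flag \<A> X" "incident_flag \<A> c\<^sub>0 X"
  obtains c where "c \<in> chambers \<A>"
    and "\<Union>\<I> \<subseteq> separation_set \<A> c\<^sub>0 c" and "separation_set \<A> c\<^sub>0 c \<subseteq> K"
proof -
  let ?r = "arrangement_rank \<A>"
  have KA: "K \<subseteq> \<A>" using K by (simp add: two_closed_def)
  obtain x where x: "\<forall>H\<in>\<A>. X ?r \<subseteq> H \<longrightarrow>
      n H \<bullet> x \<noteq> 0 \<and> (H \<in> \<Union>\<I> \<longrightarrow> n H \<bullet> x < 0) \<and> (n H \<bullet> x < 0 \<longrightarrow> H \<in> K)"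
    using separating_point[OF I K flag order_refl] by blast
  have Xr: "X ?r \<in> intersection_lattice \<A>" "codim (X ?r) = codim (\<Inter>\<A>)"
    using flag unfolding modular_flag_def flats_of_codim_def arrangement_rank_def by auto
  have sub: "subspace H" if "H \<in> \<A>" for H
    using normal[OF that] subspace_hyperplane[of "n H"] by simp
  \<comment> \<open>Every flat contains \<open>\<Inter>\<A>\<close>, and the last flag member has
    the same codimension; by equality \<open>X ?r \<subseteq> H\<close> holds for every
    \<open>H\<close> in \<open>\<A>\<close>.\<close>
  have "\<Inter>\<A> = X ?r"
  proof (rule subspace_dim_equal)
    show "subspace (\<Inter>\<A>)" using sub by (intro subspace_Inter) auto
    show "subspace (X ?r)"
      using Xr(1) sub unfolding intersection_lattice_def by (force intro!: subspace_Inter)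
    show "\<Inter>\<A> \<subseteq> X ?r" using Xr(1) unfolding intersection_lattice_def by auto
    show "dim (X ?r) \<le> dim (\<Inter>\<A>)"
      using Xr(2) dim_subset_UNIV[of "X ?r"] dim_subset_UNIV[of "\<Inter>\<A>"]
      unfolding codim_def by linarith
  qed
  then have x: "n H \<bullet> x \<noteq> 0" "H \<in> \<Union>\<I> \<longrightarrow> n H \<bullet> x < 0" "n H \<bullet> x < 0 \<longrightarrow> H \<in> K"
    if "H \<in> \<A>" for H
    using x that by blast+
  then have "\<And>H. H \<in> \<A> \<Longrightarrow> x \<notin> H" using in_hyperplane_iff by blast
  then obtain c where c: "c \<in> chambers \<A>" "x \<in> c"
    using chamber_through_point by blast
  show thesis
  proof (rule that[OF c(1)])
    show "\<Union>\<I> \<subseteq> separation_set \<A> c\<^sub>0 c"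
      unfolding separation_set_eq[OF c] using x(2) I KA by blast
    show "separation_set \<A> c\<^sub>0 c \<subseteq> K"
      unfolding separation_set_eq[OF c] using x(3) by blast
  qed
qed

end

section \<open>Choice of normals, biclosed sets and joins\<close>

text \<open>The sign of each normal is fixed at one point \<open>p\<close> of
  \<open>c\<^sub>0\<close>; constancy of sign extends it to the whole chamber.\<close>

lemma oriented_arrangement_exists:
  fixes \<A> :: "'a::euclidean_space set set"
  assumes "central_arrangement \<A>" and c: "c\<^sub>0 \<in> chambers \<A>"
  shows "\<exists>n. oriented_arrangement \<A> c\<^sub>0 n"
proof -
  obtain p where p: "p \<in> c\<^sub>0" using chamber_nonempty[OF c] by blast
  have "\<exists>a. H = {x. a \<bullet> x = 0} \<and> a \<bullet> p > 0" if H: "H \<in> \<A>" for H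
  proof -
    obtain a where a: "H = {x. a \<bullet> x = 0}"
      using hyperplane_normal assms(1) H unfolding central_arrangement_def by metis
    have "a \<bullet> p \<noteq> 0" using chamber_disjoint[OF c H p] a by simp
    then consider "a \<bullet> p > 0" | "- a \<bullet> p > 0" by fastforce
    then show ?thesis using a by cases (auto intro: exI[of _ "- a"])
  qed
  then obtain n where n: "\<And>H. H \<in> \<A> \<Longrightarrow> H = {x. n H \<bullet> x = 0} \<and> n H \<bullet> p > 0"
    by metis
  have "oriented_arrangement \<A> c\<^sub>0 n"
  proof
    show "finite \<A>" using assms(1) by (simp add: central_arrangement_def)
    show "n H \<bullet> x > 0" if "H \<in> \<A>" "x \<in> c\<^sub>0" for H x
      using chamber_sign_constant[OF c _ p that(2)] n[OF that(1)] that(1) by metis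
  qed (use c n in auto)
  then show ?thesis by blast
qed

theorem theorem6p4:
  fixes \<A> :: "(real ^ 'n) set set" and c\<^sub>0 :: "(real ^ 'n) set"
  assumes "central_arrangement \<A>"
    and "supersolvable \<A>"
    and "c\<^sub>0 \<in> chambers \<A>"
    and "\<exists>X. modular_flag \<A> X \<and> incident_flag \<A> c\<^sub>0 X"
  shows "(\<forall>I. I \<subseteq> \<A> \<longrightarrow>
            ((\<exists>c\<in>chambers \<A>. I = separation_set \<A> c\<^sub>0 c) \<longleftrightarrow> biclosed \<A> c\<^sub>0 I)) \<and>
         (\<forall>c\<in>chambers \<A>. \<forall>d\<in>chambers \<A>.
            is_lub (chamber_poset \<A> c\<^sub>0) (c \<squnion>\<^bsub>chamber_poset \<A> c\<^sub>0\<^esub> d) {c, d} \<and>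
            separation_set \<A> c\<^sub>0 (c \<squnion>\<^bsub>chamber_poset \<A> c\<^sub>0\<^esub> d) =
              two_closure \<A> c\<^sub>0 (separation_set \<A> c\<^sub>0 c \<union> separation_set \<A> c\<^sub>0 d))"
proof -
  obtain n where "oriented_arrangement \<A> c\<^sub>0 n"
    using oriented_arrangement_exists assms(1,3) by blast
  then interpret oriented_arrangement \<A> c\<^sub>0 n .
  obtain X where flag: "modular_flag \<A> X" "incident_flag \<A> c\<^sub>0 X"
    using assms(4) by blast
  let ?S = "separation_set \<A> c\<^sub>0" and ?P = "chamber_poset \<A> c\<^sub>0"
  show ?thesis
  proof (intro conjI allI impI ballI)
    fix I
    show "(\<exists>c\<in>chambers \<A>. I = ?S c) \<longleftrightarrow> biclosed \<A> c\<^sub>0 I"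
    proof
      assume "biclosed \<A> c\<^sub>0 I"
      then obtain c where "c \<in> chambers \<A>" "\<Union>{I} \<subseteq> ?S c" "?S c \<subseteq> I"
        using separating_chamber[of "{I}" I, OF _ _ flag] by (auto simp: biclosed_def)
      then show "\<exists>c\<in>chambers \<A>. I = ?S c" by blast
    qed (use separation_set_biclosed in blast)
  next
    fix c d assume cd: "c \<in> chambers \<A>" "d \<in> chambers \<A>"
    let ?K = "two_closure \<A> c\<^sub>0 (?S c \<union> ?S d)"
    have SA: "?S c \<union> ?S d \<subseteq> \<A>" by (auto simp: separation_set_def)
    have sup: "?S c \<union> ?S d \<subseteq> ?K" by (rule two_closure_superset)
    obtain e where e: "e \<in> chambers \<A>" "\<Union>{?S c, ?S d} \<subseteq> ?S e" "?S e \<subseteq> ?K"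
      using separating_chamber[of "{?S c, ?S d}" ?K, OF _ two_closed_two_closure[OF SA] flag]
        sup cd separation_set_biclosed unfolding biclosed_def by blast
    \<comment> \<open>Separation sets are themselves 2-closed, so one that contains the union
      contains its 2-closure.\<close>
    have least: "?K \<subseteq> ?S f" if "f \<in> chambers \<A>" "?S c \<union> ?S d \<subseteq> ?S f" for f
      using that separation_set_biclosed[of f] by (intro two_closure_least) (auto simp: biclosed_def)
    \<comment> \<open>The join is a Hilbert choice among least upper bounds. All of them are
      therefore characterized, and \<open>e\<close> shows that one exists.\<close>
    have lub_iff: "is_lub ?P f {c, d} \<longleftrightarrow> f \<in> chambers \<A> \<and> ?S f = ?K" for f
    proof
      assume "is_lub ?P f {c, d}"
      then have "f \<in> chambers \<A>" "?S c \<union> ?S d \<subseteq> ?S f" "?S f \<subseteq> ?S e"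
        using e cd by (auto simp: least_def Upper_def chamber_poset_def)
      then show "f \<in> chambers \<A> \<and> ?S f = ?K" using e least by blast
    next
      assume "f \<in> chambers \<A> \<and> ?S f = ?K"
      then show "is_lub ?P f {c, d}"
        using sup least cd by (auto simp: least_def Upper_def chamber_poset_def)
    qed
    have "?K \<subseteq> ?S e" using least[OF e(1)] e(2) by simp
    with e(3) have "?S e = ?K" by (rule subset_antisym)
    then have "is_lub ?P e {c, d}" using lub_iff e(1) by simp
    then show lub: "is_lub ?P (c \<squnion>\<^bsub>?P\<^esub> d) {c, d}"
      unfolding join_def sup_def by (rule someI)
    then show "?S (c \<squnion>\<^bsub>?P\<^esub> d) = ?K" unfolding lub_iff by (rule conjunct2)
  qed
qed

end
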